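(* Let $X$ be a Banach space, let $(A_n)_{n\in\mathbb{N}}$ be a sequence in $\mathcal{B}(X)$ defining the system $(\mathcal{A}):\ x_{n+1}=A_nx_n$, let $h,k:\mathbb{N}\to[1,\infty)$ be growth rates, and let $(P_n)_{n\in\mathbb{N}}$ be a sequence of projectors that is strongly invariant for $(\mathcal{A})$, with complementary sequence $Q_n=I-P_n$ and skew-evolution operator $B$. Suppose there exist a sequence of norms $\{|||\cdot|||_n : n\in\mathbb{N}\}$ on $X$, compatible with $(P_n)$, and a nondecreasing sequence $d:\mathbb{N}\to[1,\infty)$ such that for all $m\ge n\ge 0$ and all $x\in X$: $$\sum_{j=n}^{m}h_j\,|||A_j^nP_nx|||_j\le d_nh_n\,|||x|||_n \quad\text{and}\quad \sum_{j=n}^{m}k_j\,|||B_j^nQ_jx|||_n\le d_mk_n\,|||x|||_m .$$ Then the pair $(\mathcal{A},P)$ is $(h,k)$-dichotomic.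
   Context: $\mathbb{N}$ is the set of nonnegative integers, $\mathcal{B}(X)$ is the algebra of bounded linear operators on $X$, $\|\cdot\|$ denotes the norm on $X$ and on $\mathcal{B}(X)$, and $I$ is the identity. For $m\ge n$, the evolution operator is $A_m^n=A_{m-1}\cdots A_n$ if $m>n$ and $A_n^n=I$. A sequence $(P_n)$ in $\mathcal{B}(X)$ is a sequence of projectors if $P_n^2=P_n$ for all $n$. It is invariant for $(\mathcal{A})$ if $A_nP_n=P_{n+1}A_n$ for all $n$. It is strongly invariant if it is invariant and, for all $m\ge n$, the restriction of $A_m^n$ to $\operatorname{Ker}P_n$ is an isomorphism from $\operatorname{Ker}P_n$ onto $\operatorname{Ker}P_m$. In that case, for $m\ge n$, $B_m^n$ (the skew-evolution operator) denotes the isomorphism $\operatorname{Ker}P_m\to\operatorname{Ker}P_n$ inverse to $A_m^n|_{\operatorname{Ker}P_n}$, so that $A_m^nB_m^nQ_m=Q_m$, $B_m^nA_m^nQ_n=Q_n$ and $Q_nB_m^nQ_m=B_m^nQ_m$. A growth rate is an increasing sequence $h:\mathbb{N}\to[1,\infty)$ with $\lim_{n\to\infty}h_n=\infty$. The pair $(\mathcal{A},P)$ is $(h,k)$-dichotomic if there is a nondecreasing sequence $d:\mathbb{N}\to[1,\infty)$ such that $h_m\|A_m^nP_nx\|\le d_nh_n\|P_nx\|$ and $k_m\|Q_nx\|\le d_mk_n\|A_m^nQ_nx\|$ for all $m\ge n\ge0$ and $x\in X$. A sequence of norms $\{|||\cdot|||_n\}$ on $X$ is compatible with $(P_n)$ if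 there is a nondecreasing sequence $c:\mathbb{N}\to[1,\infty)$ such that $\|x\|\le|||x|||_n\le c_n(\|P_nx\|+\|Q_nx\|)$ for all $n\in\mathbb{N}$, $x\in X$. *)

theory Defs
  imports "HOL-Analysis.Analysis"
begin

text \<open>
  The state space is a real Banach space. A complex Banach space is covered by restricting scalars:
  bounded complex-linear operators and complex norms are in particular real ones.
\<close>

text \<open>\<open>evolution A m n\<close> is $A_m^n$; the value for \<open>m < n\<close> is irrelevant.\<close>

primrec evolution :: "(nat \<Rightarrow> 'a::banach \<Rightarrow>\<^sub>L 'a) \<Rightarrow> nat \<Rightarrow> nat \<Rightarrow> 'a \<Rightarrow>\<^sub>L 'a" where
  "evolution A 0 n = id_blinfun"
| "evolution A (Suc m) n = (if n \<le> m then A m o\<^sub>L evolution A m n else id_blinfun)"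

definition Ker :: "('a::banach \<Rightarrow>\<^sub>L 'a) \<Rightarrow> 'a set" where
  "Ker T = {x. blinfun_apply T x = 0}"

definition projectors :: "(nat \<Rightarrow> 'a::banach \<Rightarrow>\<^sub>L 'a) \<Rightarrow> bool" where
  "projectors P \<longleftrightarrow> (\<forall>n. P n o\<^sub>L P n = P n)"

definition compl_proj :: "(nat \<Rightarrow> 'a::banach \<Rightarrow>\<^sub>L 'a) \<Rightarrow> nat \<Rightarrow> 'a \<Rightarrow>\<^sub>L 'a" where
  "compl_proj P n = id_blinfun - P n"

definition invariant :: "(nat \<Rightarrow> 'a::banach \<Rightarrow>\<^sub>L 'a) \<Rightarrow> (nat \<Rightarrow> 'a \<Rightarrow>\<^sub>L 'a) \<Rightarrow> bool" where
  "invariant A P \<longleftrightarrow> (\<forall>n. A n o\<^sub>L P n = P (Suc n) o\<^sub>L A n)"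

text \<open>
  Isomorphisms between the (closed) kernels are topological ones. Linearity is automatic, since
  the map is the restriction of a bounded linear operator.
\<close>

definition strongly_invariant :: "(nat \<Rightarrow> 'a::banach \<Rightarrow>\<^sub>L 'a) \<Rightarrow> (nat \<Rightarrow> 'a \<Rightarrow>\<^sub>L 'a) \<Rightarrow> bool" where
  "strongly_invariant A P \<longleftrightarrow> invariant A P \<and>
     (\<forall>m n. n \<le> m \<longrightarrow>
        (\<exists>g. homeomorphism (Ker (P n)) (Ker (P m)) (blinfun_apply (evolution A m n)) g))"

text \<open>
  \<open>skew_evolution A P m n\<close> is $B_m^n$. It is meaningful only for strongly invariant \<open>P\<close>,
  \<open>n \<le> m\<close> and arguments in \<open>Ker (P m)\<close>.
\<close>

definition skew_evolution ::
  "(nat \<Rightarrow> 'a::banach \<Rightarrow>\<^sub>L 'a) \<Rightarrow> (nat \<Rightarrow> 'a \<Rightarrow>\<^sub>L 'a) \<Rightarrow> nat \<Rightarrow> nat \<Rightarrow> 'a \<Rightarrow> 'a" where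
  "skew_evolution A P m n = inv_into (Ker (P n)) (blinfun_apply (evolution A m n))"

text \<open>
  ``Increasing'' is read in the weak sense, so strictly increasing sequences are included.
\<close>

definition growth_rate :: "(nat \<Rightarrow> real) \<Rightarrow> bool" where
  "growth_rate h \<longleftrightarrow> incseq h \<and> (\<forall>n. 1 \<le> h n) \<and> filterlim h at_top sequentially"

definition nondecreasing_ge1 :: "(nat \<Rightarrow> real) \<Rightarrow> bool" where
  "nondecreasing_ge1 d \<longleftrightarrow> incseq d \<and> (\<forall>n. 1 \<le> d n)"

definition dichotomic ::
  "(nat \<Rightarrow> real) \<Rightarrow> (nat \<Rightarrow> real) \<Rightarrow>
   (nat \<Rightarrow> 'a::banach \<Rightarrow>\<^sub>L 'a) \<Rightarrow> (nat \<Rightarrow> 'a \<Rightarrow>\<^sub>L 'a) \<Rightarrow> bool" where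
  "dichotomic h k A P \<longleftrightarrow>
     (\<exists>d. nondecreasing_ge1 d \<and>
       (\<forall>m n x. n \<le> m \<longrightarrow>
          h m * norm (evolution A m n (P n x)) \<le> d n * h n * norm (P n x) \<and>
          k m * norm (compl_proj P n x) \<le> d m * k n * norm (evolution A m n (compl_proj P n x))))"

definition is_norm :: "('a::real_vector \<Rightarrow> real) \<Rightarrow> bool" where
  "is_norm N \<longleftrightarrow>
     (\<forall>x. 0 \<le> N x) \<and> (\<forall>x. N x = 0 \<longleftrightarrow> x = 0) \<and>
     (\<forall>r x. N (r *\<^sub>R x) = \<bar>r\<bar> * N x) \<and> (\<forall>x y. N (x + y) \<le> N x + N y)"

definition compatible_norms ::
  "(nat \<Rightarrow> 'a::banach \<Rightarrow> real) \<Rightarrow> (nat \<Rightarrow> 'a \<Rightarrow>\<^sub>L 'a) \<Rightarrow> bool" where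
  "compatible_norms N P \<longleftrightarrow> (\<forall>n. is_norm (N n)) \<and>
     (\<exists>c. nondecreasing_ge1 c \<and>
       (\<forall>n x. norm x \<le> N n x \<and> N n x \<le> c n * (norm (P n x) + norm (compl_proj P n x))))"

end

theory Submission
  imports Defs
begin

lemma compl_proj_apply: "compl_proj P n x = x - P n x"
  by (simp add: compl_proj_def minus_blinfun.rep_eq)

lemma projectors_apply:
  assumes "projectors P"
  shows "P n (P n x) = P n x"
  using assms unfolding projectors_def by (metis blinfun_apply_blinfun_compose)

lemma compl_proj_in_Ker:
  assumes "projectors P"
  shows "compl_proj P n x \<in> Ker (P n)"
  by (simp add: Ker_def compl_proj_apply blinfun.diff_right projectors_apply[OF assms])

lemma evolution_in_Ker:
  assumes "strongly_invariant A P" "n \<le> m" "x \<in> Ker (P n)"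
  shows "evolution A m n x \<in> Ker (P m)"
  using assms unfolding strongly_invariant_def homeomorphism_def by blast

text \<open>A homeomorphism is injective on its domain, and injectivity on \<open>Ker (P n)\<close>
  is what lets \<open>inv_into\<close> undo the evolution there.\<close>

lemma skew_evolution_evolution:
  assumes "strongly_invariant A P" "n \<le> m" "x \<in> Ker (P n)"
  shows "skew_evolution A P m n (evolution A m n x) = x"
proof -
  obtain g where "homeomorphism (Ker (P n)) (Ker (P m)) (evolution A m n) g"
    using assms(1,2) unfolding strongly_invariant_def by blast
  then have "inj_on (evolution A m n) (Ker (P n))"
    by (metis homeomorphism_apply1 inj_on_inverseI)
  then show ?thesis
    unfolding skew_evolution_def using assms(3) by (rule inv_into_f_f)
qed

lemma last_le_sum:
  fixes f :: "nat \<Rightarrow> real"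
  assumes "n \<le> m" "\<And>j. 0 \<le> f j"
  shows "f m \<le> (\<Sum>j=n..m. f j)"
  by (rule member_le_sum) (use assms in auto)

text \<open>
  Keep only the last term of each sum. Evaluating the first estimate at \<open>P n x\<close> and the second
  at \<open>evolution A m n (compl_proj P n x)\<close> makes one of the two summands in the upper
  compatibility bound vanish, so \<open>\<lambda>n. c n * d n\<close> is a dichotomy sequence.
\<close>

theorem theorem8:
  fixes A P :: "nat \<Rightarrow> 'a::banach \<Rightarrow>\<^sub>L 'a"
    and h k :: "nat \<Rightarrow> real"
  assumes "growth_rate h" and "growth_rate k"
    and "projectors P" and "strongly_invariant A P"
    and "\<exists>(N :: nat \<Rightarrow> 'a \<Rightarrow> real) (d :: nat \<Rightarrow> real).
      compatible_norms N P \<and> nondecreasing_ge1 d \<and>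
      (\<forall>m n x. n \<le> m \<longrightarrow>
        (\<Sum>j=n..m. h j * N j (evolution A j n (P n x))) \<le> d n * h n * N n x \<and>
        (\<Sum>j=n..m. k j * N n (skew_evolution A P j n (compl_proj P j x))) \<le> d m * k n * N m x)"
  shows "dichotomic h k A P"
proof -
  obtain N d where N: "compatible_norms N P" and d: "nondecreasing_ge1 d"
    and sum_h: "\<And>m n x. n \<le> m \<Longrightarrow>
      (\<Sum>j=n..m. h j * N j (evolution A j n (P n x))) \<le> d n * h n * N n x"
    and sum_k: "\<And>m n x. n \<le> m \<Longrightarrow>
      (\<Sum>j=n..m. k j * N n (skew_evolution A P j n (compl_proj P j x))) \<le> d m * k n * N m x"
    using assms(5) by blast
  obtain c where c: "nondecreasing_ge1 c"
    and lower: "\<And>n x. norm x \<le> N n x"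
    and upper: "\<And>n x. N n x \<le> c n * (norm (P n x) + norm (compl_proj P n x))"
    using N unfolding compatible_norms_def by blast
  \<comment> \<open>The lower compatibility bound gives the sign, which makes it legitimate to drop
    all terms but the last from both sums.\<close>
  have N_nonneg: "0 \<le> N n x" for n x
    using lower norm_ge_zero by (rule order_trans[rotated])
  have h: "0 \<le> h n" and k: "0 \<le> k n" and d_nonneg: "0 \<le> d n" and c_nonneg: "0 \<le> c n" for n
    using assms(1,2) c d unfolding growth_rate_def nondecreasing_ge1_def
    by (meson order_trans zero_le_one)+
  have cd: "nondecreasing_ge1 (\<lambda>n. c n * d n)"
    unfolding nondecreasing_ge1_def
  proof
    \<comment> \<open>Monotonicity passes to the product because both factors are
      nonnegative.\<close>
    show "incseq (\<lambda>n. c n * d n)"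
      using c d c_nonneg d_nonneg unfolding nondecreasing_ge1_def incseq_def
      by (simp add: mult_mono)
    show "\<forall>n. 1 \<le> c n * d n"
      using c d mult_mono[of 1 _ 1] unfolding nondecreasing_ge1_def by fastforce
  qed
  have stable: "h m * norm (evolution A m n (P n x)) \<le> c n * d n * h n * norm (P n x)"
    if "n \<le> m" for m n x
  proof -
    have "h m * norm (evolution A m n (P n x)) \<le> h m * N m (evolution A m n (P n x))"
      by (intro mult_left_mono lower h)
    also have "\<dots> \<le> (\<Sum>j=n..m. h j * N j (evolution A j n (P n x)))"
      by (rule last_le_sum) (use that h N_nonneg in auto)
    \<comment> \<open>Idempotence collapses \<open>P n (P n x)\<close> on the left, while the right
      side keeps the projected argument.\<close>
    also have "\<dots> \<le> d n * h n * N n (P n x)"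
      using sum_h[OF that, of "P n x"] by (simp add: projectors_apply[OF assms(3)])
    also have "\<dots> \<le> d n * h n * (c n * norm (P n x))"
      using upper[of n "P n x"] h d_nonneg
      by (intro mult_left_mono) (auto simp: compl_proj_apply projectors_apply[OF assms(3)])
    finally show ?thesis
      by (simp add: mult_ac)
  qed
  have unstable: "k m * norm (compl_proj P n x)
      \<le> c m * d m * k n * norm (evolution A m n (compl_proj P n x))"
    if "n \<le> m" for m n x
  proof -
    define y where "y = evolution A m n (compl_proj P n x)"
    have ker: "compl_proj P n x \<in> Ker (P n)"
      by (rule compl_proj_in_Ker[OF assms(3)])
    \<comment> \<open>Used twice: it gives \<open>compl_proj P m y = y\<close>, so the skew
      evolution acts on \<open>y\<close> itself, and it removes the \<open>P m\<close> summand from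
      the upper bound for \<open>N m y\<close>.\<close>
    have Py: "P m y = 0"
      using evolution_in_Ker[OF assms(4) that ker] by (simp add: y_def Ker_def)
    have "k m * norm (compl_proj P n x) \<le> k m * N n (compl_proj P n x)"
      by (intro mult_left_mono lower k)
    also have "\<dots> = k m * N n (skew_evolution A P m n (compl_proj P m y))"
      using skew_evolution_evolution[OF assms(4) that ker] Py
      by (simp add: y_def compl_proj_apply)
    \<comment> \<open>\<open>last_le_sum\<close> asks for nonnegativity at every \<open>j\<close>,
      even \<open>j < n\<close>, where \<open>skew_evolution\<close> has no intended meaning;
      \<open>N n\<close> is nonnegative at any argument.\<close>
    also have "\<dots> \<le> (\<Sum>j=n..m. k j * N n (skew_evolution A P j n (compl_proj P j y)))"
      by (rule last_le_sum) (use that k N_nonneg in auto)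
    also have "\<dots> \<le> d m * k n * N m y"
      by (rule sum_k[OF that])
    \<comment> \<open>Compatibility is applied at time \<open>m\<close>, so the constant carries the
      index \<open>m\<close> that the unstable half of \<open>dichotomic\<close> demands.\<close>
    also have "\<dots> \<le> d m * k n * (c m * norm y)"
      using upper[of m y] k d_nonneg Py
      by (intro mult_left_mono) (auto simp: compl_proj_apply)
    finally show ?thesis
      by (simp add: y_def mult_ac)
  qed
  show ?thesis
    unfolding dichotomic_def using cd stable unstable by blast
qed

end
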